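(* There is a constant $c>0$ such that for every sufficiently large $n$ that is a perfect square, every deterministic $\mathsf{Online}$-$\mathsf{LOCAL}$ algorithm that properly 3-colors every $(\sqrt{n}\times\sqrt{n})$ simple grid (for every identifier assignment and every processing order chosen by the adversary) has locality $T(n)\ge c\log n$. In other words, the locality of 3-coloring $(\sqrt{n}\times\sqrt{n})$ simple grids in the $\mathsf{Online}$-$\mathsf{LOCAL}$ model is $\Omega(\log n)$.
   Context: For a graph $G=(V,E)$, $U\subseteq V$ and an integer $T\ge 0$, $\mathcal{B}(U,T)$ denotes the set of nodes at distance at most $T$ from some node of $U$, and $G[U]$ denotes the induced subgraph. The $\mathsf{Online}$-$\mathsf{LOCAL}$ model: an algorithm with locality $T=T(n)$ is deterministic and knows $n$. The adversary chooses an $n$-node input graph $G=(V,E)$ from the input family, assigns distinct identifiers from $\{1,\dots,\mathrm{poly}(n)\}$ to its nodes, and chooses an ordering $\sigma=(v_1,\dots,v_n)$ of $V$. For $i=1,\dots,n$, when $v_i$ is presented, the algorithm must irrevocably assign an output (here a color) to $v_i$ as a function of the sequence $(v_1,\dots,v_i)$ and the induced subgraph $G_i=G\big[\bigcup_{j\le i}\mathcal{B}(v_j,T)\big]$ (with identifiers); thus the algorithm has global memory of everything seen so far. The algorithm solves a coloring problem on an input family if for every choice of the adversary the final coloring is proper and uses only the allowed colors. The locality of a problem is the minimum locality of an algorithm solving it. An $(a\times b)$ simple grid has node set $\{(i,j): i\in[a], j\in[b]\}$, with $(i,j)$ and $(i',j')$ adjacent iff $|i-i'|+|j-j'|=1$.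 *)

theory Defs
  imports Complex_Main
begin

type_synonym node = "nat \<times> nat"

definition grid :: "nat \<Rightarrow> node set" where
  "grid m = {(i, j). i < m \<and> j < m}"

definition grid_edges :: "nat \<Rightarrow> (node \<times> node) set" where
  "grid_edges m = {((i, j), (i', j')). (i, j) \<in> grid m \<and> (i', j') \<in> grid m \<and>
      (if i \<le> i' then i' - i else i - i') + (if j \<le> j' then j' - j else j - j') = 1}"

definition ball :: "nat \<Rightarrow> node set \<Rightarrow> nat \<Rightarrow> node set" where
  "ball m U T = {v. \<exists>u\<in>U. \<exists>k\<le>T. (u, v) \<in> (grid_edges m) ^^ k}"

text \<open>What an Online-LOCAL algorithm sees: the identifiers of the presented nodes in order,
  and the induced subgraph on the union of their T-balls, with identifiers.\<close>
type_synonym view = "nat list \<times> nat set \<times> (nat \<times> nat) set"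

definition online_view :: "nat \<Rightarrow> (node \<Rightarrow> nat) \<Rightarrow> node list \<Rightarrow> nat \<Rightarrow> view" where
  "online_view m ident pre T =
     (let S = ball m (set pre) T in
      (map ident pre, ident ` S,
       {(ident u, ident v) | u v. u \<in> S \<and> v \<in> S \<and> (u, v) \<in> grid_edges m}))"

text \<open>A deterministic algorithm, knowing n, maps views to colors.
  The i-th presented node (0-indexed) receives color A n (view of prefix of length i+1).\<close>
definition online_coloring ::
  "(nat \<Rightarrow> view \<Rightarrow> nat) \<Rightarrow> nat \<Rightarrow> nat \<Rightarrow> nat \<Rightarrow> (node \<Rightarrow> nat) \<Rightarrow> node list \<Rightarrow> node \<Rightarrow> nat" where
  "online_coloring A n T m ident \<sigma> v =
     A n (online_view m ident (take (Suc (THE i. i < length \<sigma> \<and> \<sigma> ! i = v)) \<sigma>) T)"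

definition solves_grid_3col :: "(nat \<Rightarrow> view \<Rightarrow> nat) \<Rightarrow> nat \<Rightarrow> nat \<Rightarrow> bool" where
  "solves_grid_3col A n T \<longleftrightarrow>
     (\<forall>m ident \<sigma>. m * m = n \<longrightarrow> inj_on ident (grid m) \<longrightarrow> ident ` grid m \<subseteq> {1..n} \<longrightarrow>
        distinct \<sigma> \<longrightarrow> set \<sigma> = grid m \<longrightarrow>
        (let col = online_coloring A n T m ident \<sigma> in
           (\<forall>v\<in>grid m. col v < 3) \<and> (\<forall>(u, v)\<in>grid_edges m. col u \<noteq> col v)))"

end

theory Submission
  imports Defs
begin

text \<open>A proper 3-coloring of a row of the grid lifts to a height function: an integer function that
  is congruent to the color modulo 3 and changes by 1 at every step. Every 4-cycle has total height
  change 0, so height differences along two adjacent rows differ by at most 2. The adversary shows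
  the algorithm many row segments that are too far apart to be seen in relation to each other, and
  fixes their relative positions only later. Joining two segments at a gap of suitable parity
  increases the variation of the height function by 1 while roughly doubling the length, so segments
  of length exponential in \<open>T\<close> have variation at least \<open>2 T + 3\<close>. Among sufficiently many of them, two
  have this variation between the same offsets; placing one above the other, reversed, at distance
  \<open>2 T + 2\<close> contradicts the bound for adjacent rows.\<close>

section \<open>Height functions of properly coloured rows\<close>

text \<open>The lift of a walk in the triangle of colors to its universal cover, the integer line.
  Values outside \<open>{lo..hi}\<close> are left free.\<close>

definition is_height :: "(int \<Rightarrow> nat) \<Rightarrow> (int \<Rightarrow> int) \<Rightarrow> int \<Rightarrow> int \<Rightarrow> bool" where
  "is_height \<kappa> h lo hi \<longleftrightarrow>
     (\<forall>t\<in>{lo..hi}. h t mod 3 = int (\<kappa> t)) \<and> (\<forall>t\<in>{lo..<hi}. \<bar>h (t + 1) - h t\<bar> = 1)"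

lemma is_height_exists:
  assumes "\<forall>t\<in>{lo..hi}. \<kappa> t < 3" and "\<forall>t\<in>{lo..<hi}. \<kappa> t \<noteq> \<kappa> (t + 1)"
  shows "\<exists>h. is_height \<kappa> h lo hi"
proof (cases "lo \<le> hi")
  case True
  then show ?thesis using assms
  proof (induction hi rule: int_ge_induct)
    case base
    then show ?case
      by (intro exI[of _ "\<lambda>t. int (\<kappa> t)"]) (auto simp: is_height_def)
  next
    case (step i)
    have "\<exists>h. is_height \<kappa> h lo i"
      using step.prems by (intro step.IH) auto
    then obtain h where h: "is_height \<kappa> h lo i" ..
    have hi: "h i mod 3 = int (\<kappa> i)" using h step.hyps by (auto simp: is_height_def)
    have "\<kappa> (i + 1) < 3" "\<kappa> i \<noteq> \<kappa> (i + 1)" "\<kappa> i < 3" using step.prems step.hyps by auto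
    then have "(h i mod 3 + 1) mod 3 = int (\<kappa> (i + 1)) \<or> (h i mod 3 - 1) mod 3 = int (\<kappa> (i + 1))"
      unfolding hi by (auto simp: less_Suc_eq numeral_3_eq_3)
    then obtain d :: int where d: "d = 1 \<or> d = - 1" "(h i + d) mod 3 = int (\<kappa> (i + 1))"
      using that[of 1] that[of "- 1"] by (auto simp: mod_simps)
    then have d: "\<bar>d\<bar> = 1" "(h i + d) mod 3 = int (\<kappa> (i + 1))" by auto
    have "is_height \<kappa> (h(i + 1 := h i + d)) lo (i + 1)"
      using h d by (auto simp: is_height_def)
    then show ?case by (intro exI[of _ "h(i + 1 := h i + d)"])
  qed
next
  case False
  then show ?thesis by (auto simp: is_height_def)
qed

lemma is_height_sub:
  assumes "is_height \<kappa> h lo hi" "lo \<le> lo'" "hi' \<le> hi"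
  shows "is_height \<kappa> h lo' hi'"
  using assms by (auto simp: is_height_def)

lemma is_height_shift:
  assumes "is_height \<kappa> h (lo + c) (hi + c)"
  shows "is_height (\<lambda>t. \<kappa> (t + c)) (\<lambda>t. h (t + c)) lo hi"
  unfolding is_height_def
proof safe
  fix t assume "t \<in> {lo..hi}"
  then show "h (t + c) mod 3 = int (\<kappa> (t + c))"
    using assms by (auto simp: is_height_def)
next
  fix t assume "t \<in> {lo..<hi}"
  then have "t + c \<in> {lo + c..<hi + c}" by auto
  then have "\<bar>h (t + c + 1) - h (t + c)\<bar> = 1"
    using assms by (auto simp: is_height_def)
  then show "\<bar>h (t + 1 + c) - h (t + c)\<bar> = 1" by (simp add: algebra_simps)
qed

lemma is_height_reflect:
  assumes "is_height \<kappa> h (c - hi) (c - lo)"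
  shows "is_height (\<lambda>t. \<kappa> (c - t)) (\<lambda>t. h (c - t)) lo hi"
  unfolding is_height_def
proof safe
  fix t assume "t \<in> {lo..hi}"
  then show "h (c - t) mod 3 = int (\<kappa> (c - t))"
    using assms by (auto simp: is_height_def)
next
  fix t assume "t \<in> {lo..<hi}"
  then have "c - (t + 1) \<in> {c - hi..<c - lo}" by auto
  then have "\<bar>h (c - (t + 1) + 1) - h (c - (t + 1))\<bar> = 1"
    using assms unfolding is_height_def by blast
  then show "\<bar>h (c - (t + 1)) - h (c - t)\<bar> = 1" by (simp add: abs_minus_commute)
qed

lemma is_height_cong:
  assumes "is_height \<kappa> h lo hi" "\<And>t. t \<in> {lo..hi} \<Longrightarrow> \<kappa> t = \<kappa>' t"
  shows "is_height \<kappa>' h lo hi"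
  using assms by (auto simp: is_height_def)

lemma abs_1_mod_3_eq:
  fixes x y :: int
  assumes "\<bar>x\<bar> = 1" "\<bar>y\<bar> = 1" "x mod 3 = y mod 3"
  shows "x = y"
proof -
  have "x = 1 \<or> x = - 1" "y = 1 \<or> y = - 1" using assms by auto
  then show ?thesis using assms(3) by auto
qed

lemma is_height_unique_aux:
  assumes "is_height \<kappa> h lo hi" "is_height \<kappa> g lo hi" "t \<ge> lo" "t \<le> hi"
  shows "h t - h lo = g t - g lo"
  using assms(3,4)
proof (induction t rule: int_ge_induct)
  case (step t)
  have "\<bar>h (t + 1) - h t\<bar> = 1" "\<bar>g (t + 1) - g t\<bar> = 1"
    "h t mod 3 = int (\<kappa> t)" "g t mod 3 = int (\<kappa> t)"
    "h (t + 1) mod 3 = int (\<kappa> (t + 1))" "g (t + 1) mod 3 = int (\<kappa> (t + 1))"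
    using assms(1,2) step by (auto simp: is_height_def)
  moreover have "(h (t + 1) - h t) mod 3 = (g (t + 1) - g t) mod 3"
    by (rule mod_diff_cong) (simp_all only: calculation)
  then have "h (t + 1) - h t = g (t + 1) - g t"
    by (rule abs_1_mod_3_eq[OF calculation(1,2)])
  moreover have "h t - h lo = g t - g lo" using step by auto
  ultimately show ?case by linarith
qed simp

text \<open>The colors fix every step of a lift, since 1 and -1 differ modulo 3. Height differences
  thus depend on the coloring alone, and any lift at hand may be used to compute them.\<close>

lemma is_height_unique:
  assumes "is_height \<kappa> h lo hi" "is_height \<kappa> g lo hi" "a \<in> {lo..hi}" "b \<in> {lo..hi}"
  shows "h b - h a = g b - g a"
  using is_height_unique_aux[OF assms(1,2), of a] is_height_unique_aux[OF assms(1,2), of b]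
    assms(3,4) by auto

lemma is_height_parity:
  assumes "is_height \<kappa> h lo hi" "t \<ge> lo" "t \<le> hi"
  shows "even (h t - h lo - (t - lo))"
  using assms(2,3)
proof (induction t rule: int_ge_induct)
  case (step t)
  then have "\<bar>h (t + 1) - h t\<bar> = 1" using assms(1) by (auto simp: is_height_def)
  moreover have "even (h t - h lo - (t - lo))" using step by auto
  ultimately show ?case by presburger
qed simp

text \<open>Every step is odd, so a height difference has the parity of the distance. Placing two
  points at odd distance therefore forces their heights to differ.\<close>

lemma is_height_odd:
  assumes "is_height \<kappa> h lo hi" "a \<in> {lo..hi}" "b \<in> {lo..hi}" "odd (b - a)"
  shows "odd (h b - h a)"
  using is_height_parity[OF assms(1), of a] is_height_parity[OF assms(1), of b] assms(2-4)
  by simp presburger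

text \<open>The difference of the two height functions is odd and never divisible by 3; as it moves by
  at most 2 per step, it cannot leave \<open>{- 1, 1}\<close>.\<close>

lemma is_height_adjacent_aux:
  assumes h: "is_height \<kappa> h lo hi" and g: "is_height \<mu> g lo hi"
    and ne: "\<forall>t\<in>{lo..hi}. \<kappa> t \<noteq> \<mu> t"
    and t: "t \<ge> lo" "t \<le> hi" and base: "\<bar>g lo + c - h lo\<bar> = 1" "c mod 3 = 0"
  shows "\<bar>g t + c - h t\<bar> = 1"
  using t
proof (induction t rule: int_ge_induct)
  case base
  then show ?case using assms by simp
next
  case (step t)
  have *: "\<bar>h (t + 1) - h t\<bar> = 1" "\<bar>g (t + 1) - g t\<bar> = 1"
    "h (t + 1) mod 3 = int (\<kappa> (t + 1))" "g (t + 1) mod 3 = int (\<mu> (t + 1))"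
    using h g step by (auto simp: is_height_def)
  have "\<bar>g t + c - h t\<bar> = 1" using step by auto
  then have d: "g (t + 1) + c - h (t + 1) \<in> {- 3, - 1, 1, 3}"
    using *(1,2) by (simp add: abs_if split: if_splits)
  have "\<kappa> (t + 1) \<noteq> \<mu> (t + 1)" using ne step by auto
  then have "h (t + 1) mod 3 \<noteq> g (t + 1) mod 3" using * by simp
  moreover have "(g (t + 1) + c) mod 3 = g (t + 1) mod 3"
    using mod_add_right_eq[of "g (t + 1)" c 3] base(2) by simp
  ultimately have "(g (t + 1) + c) mod 3 \<noteq> h (t + 1) mod 3" by simp
  then have "(g (t + 1) + c - h (t + 1)) mod 3 \<noteq> 0"
    unfolding mod_eq_dvd_iff dvd_eq_mod_eq_0 .
  then show ?case using d by auto
qed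

text \<open>Adding a multiple of 3 to \<open>g\<close> keeps it a lift of the same colors. A
  suitable one, \<open>c\<close>, brings the two lifts to distance 1 at \<open>lo\<close>, hence on
  the whole window; \<open>a\<close> and \<open>b\<close> then contribute at most 1 each.\<close>

lemma is_height_adjacent:
  assumes h: "is_height \<kappa> h lo hi" and g: "is_height \<mu> g lo hi"
    and ne: "\<forall>t\<in>{lo..hi}. \<kappa> t \<noteq> \<mu> t" and ab: "a \<in> {lo..hi}" "b \<in> {lo..hi}"
  shows "\<bar>(h b - h a) - (g b - g a)\<bar> \<le> 2"
proof -
  have "h lo mod 3 = int (\<kappa> lo)" "g lo mod 3 = int (\<mu> lo)" "\<kappa> lo \<noteq> \<mu> lo"
    using h g ne ab by (auto simp: is_height_def)
  then have *: "h lo mod 3 \<noteq> g lo mod 3" by simp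
  define q where "q = (g lo - h lo) div 3"
  have "(g lo - h lo) mod 3 \<noteq> 0"
    using *[symmetric] unfolding mod_eq_dvd_iff dvd_eq_mod_eq_0 .
  then have "(g lo - h lo) mod 3 = 1 \<or> (g lo - h lo) mod 3 = 2" by presburger
  then have "g lo - h lo - 3 * q = 1 \<or> g lo - h lo - 3 * q = 2"
    unfolding q_def by (simp add: minus_mult_div_eq_mod)
  \<comment> \<open>The second shift turns the remainder 2 into -1.\<close>
  then have "\<bar>g lo + 3 * (- q) - h lo\<bar> = 1 \<or> \<bar>g lo + 3 * (- q - 1) - h lo\<bar> = 1" by auto
  then obtain x where "\<bar>g lo + 3 * x - h lo\<bar> = 1" by metis
  then obtain c where c: "\<bar>g lo + c - h lo\<bar> = 1" "c mod 3 = 0"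
    using that[of "3 * x"] by simp
  have "\<bar>g t + c - h t\<bar> = 1" if "t \<in> {lo..hi}" for t
    using that by (intro is_height_adjacent_aux[OF h g ne _ _ c]) simp_all
  from this[OF ab(1)] this[OF ab(2)]
  show ?thesis by linarith
qed

section \<open>Balls and placements of row segments\<close>

definition l1 :: "node \<Rightarrow> node \<Rightarrow> int" where
  "l1 u v = \<bar>int (fst u) - int (fst v)\<bar> + \<bar>int (snd u) - int (snd v)\<bar>"

lemma grid_edges_iff: "(u, v) \<in> grid_edges m \<longleftrightarrow> u \<in> grid m \<and> v \<in> grid m \<and> l1 u v = 1"
  by (cases u; cases v) (auto simp: grid_edges_def l1_def)

lemma relpow_grid_l1:
  "(u, v) \<in> grid_edges m ^^ k \<Longrightarrow> u \<in> grid m \<Longrightarrow> v \<in> grid m \<and> l1 u v \<le> int k"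
proof (induction k arbitrary: v)
  case 0
  then show ?case by (simp add: l1_def)
next
  case (Suc k)
  then obtain w where "(u, w) \<in> grid_edges m ^^ k" "(w, v) \<in> grid_edges m" by auto
  then have "v \<in> grid m" "l1 u w \<le> int k" "l1 w v = 1" using Suc by (auto simp: grid_edges_iff)
  then show ?case by (auto simp: l1_def)
qed

text \<open>The grid is a full square, so every \<open>v\<close> other than \<open>u\<close> has a
  neighbor in it that is one step closer to \<open>u\<close>; the cases correct the row first, then
  the column.\<close>

lemma l1_relpow_grid:
  "u \<in> grid m \<Longrightarrow> v \<in> grid m \<Longrightarrow> l1 u v = int k \<Longrightarrow> (u, v) \<in> grid_edges m ^^ k"
proof (induction k arbitrary: v)
  case 0
  then show ?case by (cases u; cases v) (auto simp: l1_def)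
next
  case (Suc k)
  obtain a b c d where uv: "u = (a, b)" "v = (c, d)" by (cases u; cases v)
  have "\<exists>w\<in>grid m. l1 u w = int k \<and> l1 w v = 1"
  proof -
    consider "a < c" | "c < a" | "a = c" "b < d" | "a = c" "d < b"
      using Suc.prems uv by (fastforce simp: l1_def)
    then show ?thesis
    proof cases
      case 1
      then show ?thesis using Suc.prems uv
        by (intro bexI[of _ "(c - 1, d)"]) (auto simp: l1_def grid_def)
    next
      case 2
      then show ?thesis using Suc.prems uv
        by (intro bexI[of _ "(c + 1, d)"]) (auto simp: l1_def grid_def)
    next
      case 3
      then show ?thesis using Suc.prems uv
        by (intro bexI[of _ "(c, d - 1)"]) (auto simp: l1_def grid_def)
    next
      case 4
      then show ?thesis using Suc.prems uv
        by (intro bexI[of _ "(c, d + 1)"]) (auto simp: l1_def grid_def)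
    qed
  qed
  then obtain w where "w \<in> grid m" "l1 u w = int k" "l1 w v = 1" by blast
  then have "(u, w) \<in> grid_edges m ^^ k" "(w, v) \<in> grid_edges m"
    using Suc by (auto simp: grid_edges_iff)
  then show ?case by auto
qed

lemma ball_l1:
  assumes "U \<subseteq> grid m"
  shows "ball m U T = {v \<in> grid m. \<exists>u\<in>U. l1 u v \<le> int T}"
proof safe
  fix a b assume "(a, b) \<in> ball m U T"
  then obtain u k where "u \<in> U" "k \<le> T" "(u, (a, b)) \<in> grid_edges m ^^ k"
    by (auto simp: ball_def)
  then show "(a, b) \<in> grid m" "\<exists>u\<in>U. l1 u (a, b) \<le> int T"
    using relpow_grid_l1[of u "(a, b)" k m] assms by force+
next
  fix a b u assume "(a, b) \<in> grid m" "u \<in> U" "l1 u (a, b) \<le> int T"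
  then have "(u, (a, b)) \<in> grid_edges m ^^ nat (l1 u (a, b))" "nat (l1 u (a, b)) \<le> T"
    using assms by (auto intro!: l1_relpow_grid simp: l1_def)
  then show "(a, b) \<in> ball m U T" using \<open>u \<in> U\<close> by (auto simp: ball_def)
qed

text \<open>Segment \<open>i\<close> of width \<open>w\<close> lies in row \<open>r i\<close>, starting at column \<open>l i\<close>, and is reversed if
  \<open>f i\<close>. In the triple \<open>(i, x, y)\<close> the offset along the segment is \<open>x\<close> (its own nodes are those
  with \<open>0 \<le> x < w\<close> and \<open>y = 0\<close>) and \<open>y\<close> is the row offset.\<close>

definition emb :: "int \<Rightarrow> (nat \<Rightarrow> int) \<Rightarrow> (nat \<Rightarrow> int) \<Rightarrow> (nat \<Rightarrow> bool) \<Rightarrow> nat \<times> int \<times> int \<Rightarrow> node" where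
  "emb w r l f = (\<lambda>(i, x, y). (nat (r i + y), nat (l i + (if f i then w - 1 - x else x))))"

text \<open>Distance at least \<open>2 T + 2\<close> keeps the \<open>T\<close>-balls of two segments disjoint and nonadjacent.\<close>

definition valid :: "nat \<Rightarrow> nat \<Rightarrow> nat \<Rightarrow> int \<Rightarrow> (nat \<Rightarrow> int) \<Rightarrow> (nat \<Rightarrow> int) \<Rightarrow> bool" where
  "valid m T M w r l \<longleftrightarrow>
     (\<forall>i<M. int T \<le> r i \<and> r i + int T < int m \<and> int T \<le> l i \<and> l i + w + int T \<le> int m) \<and>
     (\<forall>i<M. \<forall>i'<M. i \<noteq> i' \<longrightarrow> \<bar>r i - r i'\<bar> \<ge> 2 * int T + 2 \<or>
        l i + w + 2 * int T + 1 \<le> l i' \<or> l i' + w + 2 * int T + 1 \<le> l i)"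

definition core :: "nat \<Rightarrow> int \<Rightarrow> (nat \<times> int \<times> int) set" where
  "core M w = {(i, t, y). i < M \<and> 0 \<le> t \<and> t < w \<and> y = 0}"

text \<open>What the algorithm sees around the segments, described without a placement, as if each
  segment lay alone in an unbounded grid. A \<open>valid\<close> placement realizes exactly this
  picture.\<close>

definition seg_ball :: "nat \<Rightarrow> (nat \<times> int \<times> int) set \<Rightarrow> (nat \<times> int \<times> int) set" where
  "seg_ball T U = {(i, x, y). \<exists>t. (i, t, 0) \<in> U \<and> \<bar>x - t\<bar> + \<bar>y\<bar> \<le> int T}"

definition seg_adj :: "nat \<times> int \<times> int \<Rightarrow> nat \<times> int \<times> int \<Rightarrow> bool" where
  "seg_adj = (\<lambda>(i, x, y) (i', x', y'). i = i' \<and> \<bar>x - x'\<bar> + \<bar>y - y'\<bar> = 1)"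

lemma finite_core: "finite (core M w)"
proof -
  have "core M w \<subseteq> {..<M} \<times> {0..<w} \<times> {0}" by (auto simp: core_def)
  then show ?thesis by (rule finite_subset) auto
qed

lemma seg_ball_mono: "U \<subseteq> V \<Longrightarrow> seg_ball T U \<subseteq> seg_ball T V"
  by (auto simp: seg_ball_def)

lemma core_subset_seg_ball: "core M w \<subseteq> seg_ball T (core M w)"
  by (force simp: seg_ball_def core_def)

text \<open>The margin \<open>T\<close> in \<open>valid\<close> keeps \<open>nat\<close> from
  truncating, so a placement, reversed or not, is an isometry on the ball of each segment. Distinct
  segments are at least \<open>2 T + 2\<close> apart in row or in column, and the balls use up at
  most \<open>T\<close> of this on each side.\<close>

lemma emb_l1:
  assumes v: "valid m T M w r l"
    and p: "(i, x, y) \<in> seg_ball T (core M w)" and q: "(i', x', y') \<in> seg_ball T (core M w)"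
  shows "emb w r l f (i, x, y) \<in> grid m"
    and "i = i' \<Longrightarrow> l1 (emb w r l f (i, x, y)) (emb w r l f (i', x', y')) = \<bar>x - x'\<bar> + \<bar>y - y'\<bar>"
    and "i \<noteq> i' \<Longrightarrow> l1 (emb w r l f (i, x, y)) (emb w r l f (i', x', y')) \<ge> 2"
proof -
  obtain t where t: "i < M" "0 \<le> t" "t < w" "\<bar>x - t\<bar> + \<bar>y\<bar> \<le> int T"
    using p by (auto simp: seg_ball_def core_def)
  obtain t' where t': "i' < M" "0 \<le> t'" "t' < w" "\<bar>x' - t'\<bar> + \<bar>y'\<bar> \<le> int T"
    using q by (auto simp: seg_ball_def core_def)
  define X where "X = l i + (if f i then w - 1 - x else x)"
  define X' where "X' = l i' + (if f i' then w - 1 - x' else x')"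
  define Y where "Y = r i + y"
  define Y' where "Y' = r i' + y'"
  have i: "int T \<le> r i" "r i + int T < int m" "int T \<le> l i" "l i + w + int T \<le> int m"
    and i': "int T \<le> r i'" "r i' + int T < int m" "int T \<le> l i'" "l i' + w + int T \<le> int m"
    using v t t' by (auto simp: valid_def)
  \<comment> \<open>\<open>s\<close> and \<open>s'\<close> are the offsets of \<open>t\<close> and
    \<open>t'\<close> counted from the left end, which hides the reversals from the estimates
    below.\<close>
  define s where "s = (if f i then w - 1 - t else t)"
  define s' where "s' = (if f i' then w - 1 - t' else t')"
  have s: "0 \<le> s" "s < w" "\<bar>X - l i - s\<bar> = \<bar>x - t\<bar>" and s': "0 \<le> s'" "s' < w" "\<bar>X' - l i' - s'\<bar> = \<bar>x' - t'\<bar>"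
    using t t' by (auto simp: s_def s'_def X_def X'_def)
  have b: "\<bar>y\<bar> \<le> int T" "\<bar>y'\<bar> \<le> int T" "\<bar>X - l i - s\<bar> \<le> int T" "\<bar>X' - l i' - s'\<bar> \<le> int T"
    using t(4) t'(4) unfolding s(3) s'(3) by linarith+
  have X: "0 \<le> X" "X < int m" "0 \<le> Y" "Y < int m"
    using i b(1,3) s(1,2) unfolding Y_def by linarith+
  have X': "0 \<le> X'" "X' < int m" "0 \<le> Y'" "Y' < int m"
    using i' b(2,4) s'(1,2) unfolding Y'_def by linarith+
  have e: "emb w r l f (i, x, y) = (nat Y, nat X)" "emb w r l f (i', x', y') = (nat Y', nat X')"
    by (simp_all add: emb_def X_def X'_def Y_def Y'_def)
  have d: "l1 (emb w r l f (i, x, y)) (emb w r l f (i', x', y')) = \<bar>Y - Y'\<bar> + \<bar>X - X'\<bar>"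
    using X X' by (simp add: e l1_def)
  show "emb w r l f (i, x, y) \<in> grid m" using X by (auto simp: e grid_def)
  show "l1 (emb w r l f (i, x, y)) (emb w r l f (i', x', y')) = \<bar>x - x'\<bar> + \<bar>y - y'\<bar>" if "i = i'"
    unfolding d using that by (auto simp: X_def X'_def Y_def Y'_def)
  show "l1 (emb w r l f (i, x, y)) (emb w r l f (i', x', y')) \<ge> 2" if "i \<noteq> i'"
  proof -
    have "\<bar>r i - r i'\<bar> \<ge> 2 * int T + 2 \<or>
        l i + w + 2 * int T + 1 \<le> l i' \<or> l i' + w + 2 * int T + 1 \<le> l i"
      using v t t' that by (auto simp: valid_def)
    then have "\<bar>Y - Y'\<bar> \<ge> 2 \<or> \<bar>X - X'\<bar> \<ge> 2"
    proof (elim disjE)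
      assume "\<bar>r i - r i'\<bar> \<ge> 2 * int T + 2"
      then show ?thesis using b unfolding Y_def Y'_def by linarith
    next
      assume "l i + w + 2 * int T + 1 \<le> l i'"
      then have "X' - X \<ge> 2" using b s(1,2) s'(1,2) by linarith
      then show ?thesis by linarith
    next
      assume "l i' + w + 2 * int T + 1 \<le> l i"
      then have "X - X' \<ge> 2" using b s(1,2) s'(1,2) by linarith
      then show ?thesis by linarith
    qed
    then show ?thesis unfolding d by linarith
  qed
qed

lemma emb_in_grid:
  assumes "valid m T M w r l" "p \<in> seg_ball T (core M w)"
  shows "emb w r l f p \<in> grid m"
  using assms by (cases p) (auto intro: emb_l1(1))

lemma emb_core_in_grid:
  assumes "valid m T M w r l"
  shows "emb w r l f ` core M w \<subseteq> grid m"
  using emb_in_grid[OF assms] core_subset_seg_ball by blast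

lemma emb_adj:
  assumes "valid m T M w r l" "p \<in> seg_ball T (core M w)" "q \<in> seg_ball T (core M w)"
  shows "(emb w r l f p, emb w r l f q) \<in> grid_edges m \<longleftrightarrow> seg_adj p q"
proof -
  obtain i x y i' x' y' where pq: "p = (i, x, y)" "q = (i', x', y')" by (cases p; cases q)
  show ?thesis
    using emb_l1(2,3)[OF assms(1), of i x y i' x' y' f] emb_in_grid[OF assms(1,2), of f]
      emb_in_grid[OF assms(1,3), of f] assms(2,3)
    unfolding pq by (cases "i = i'") (auto simp: grid_edges_iff seg_adj_def)
qed

lemma inj_on_emb:
  assumes "valid m T M w r l"
  shows "inj_on (emb w r l f) (seg_ball T (core M w))"
proof (rule inj_onI)
  fix p q assume p: "p \<in> seg_ball T (core M w)" and q: "q \<in> seg_ball T (core M w)"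
    and eq: "emb w r l f p = emb w r l f q"
  obtain i x y i' x' y' where pq: "p = (i, x, y)" "q = (i', x', y')" by (cases p; cases q)
  have "l1 (emb w r l f p) (emb w r l f q) = 0" by (simp add: eq l1_def)
  then show "p = q"
    using emb_l1(2,3)[OF assms, of i x y i' x' y' f] p q
    unfolding pq by (cases "i = i'") auto
qed

lemma inj_on_emb_core:
  assumes "valid m T M w r l"
  shows "inj_on (emb w r l f) (core M w)"
  using inj_on_emb[OF assms] core_subset_seg_ball by (rule inj_on_subset)

lemma ball_emb:
  assumes v: "valid m T M w r l" and U: "U \<subseteq> core M w"
  shows "ball m (emb w r l f ` U) T = emb w r l f ` seg_ball T U"
proof -
  have sub: "emb w r l f ` U \<subseteq> grid m" using emb_core_in_grid[OF v] U by blast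
  have sb: "seg_ball T U \<subseteq> seg_ball T (core M w)" using U by (rule seg_ball_mono)
  show ?thesis unfolding ball_l1[OF sub]
  proof (intro subset_antisym subsetI)
    fix v assume "v \<in> {v \<in> grid m. \<exists>u\<in>emb w r l f ` U. l1 u v \<le> int T}"
    then obtain a b i t y where vab: "v = (a, b)" and u: "(i, t, y) \<in> U"
      and d: "l1 (emb w r l f (i, t, y)) (a, b) \<le> int T"
      by (cases v) auto
    have y: "y = 0" and t: "i < M" "0 \<le> t" "t < w" using u U by (auto simp: core_def)
    have i: "int T \<le> r i" "int T \<le> l i" using v t by (auto simp: valid_def)
    \<comment> \<open>\<open>x\<close> and \<open>z\<close> invert the placement at the node
      \<open>(a, b)\<close>.\<close>
    define x where "x = (if f i then w - 1 - (int b - l i) else int b - l i)"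
    define z where "z = int a - r i"
    have "emb w r l f (i, x, z) = v" by (simp add: emb_def x_def z_def vab)
    moreover have "\<bar>x - t\<bar> + \<bar>z\<bar> \<le> int T"
      using d t i by (auto simp: emb_def l1_def y x_def z_def split: if_splits)
    then have "(i, x, z) \<in> seg_ball T U" using u y by (auto simp: seg_ball_def)
    ultimately show "v \<in> emb w r l f ` seg_ball T U" by (metis imageI)
  next
    fix v assume "v \<in> emb w r l f ` seg_ball T U"
    then obtain i x y where p: "(i, x, y) \<in> seg_ball T U" and vp: "v = emb w r l f (i, x, y)"
      by auto
    have "v \<in> grid m" using emb_in_grid[OF v] sb p vp by blast
    obtain t where t: "(i, t, 0) \<in> U" "\<bar>x - t\<bar> + \<bar>y\<bar> \<le> int T" using p by (auto simp: seg_ball_def)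
    then have "(i, t, 0) \<in> seg_ball T (core M w)" using U core_subset_seg_ball by blast
    then have "l1 (emb w r l f (i, t, 0)) v = \<bar>t - x\<bar> + \<bar>0 - y\<bar>"
      using p sb unfolding vp by (intro emb_l1(2)[OF v]) auto
    then have "l1 (emb w r l f (i, t, 0)) v \<le> int T" using t by auto
    then show "v \<in> {v \<in> grid m. \<exists>u\<in>emb w r l f ` U. l1 u v \<le> int T}"
      using t \<open>v \<in> grid m\<close> by blast
  qed
qed

text \<open>The right-hand side mentions no placement: given the identifiers \<open>J\<close>, the
  algorithm cannot tell where the segments lie or which of them are reversed.\<close>

lemma online_view_emb:
  assumes v: "valid m T M w r l" and us: "set us \<subseteq> core M w"
    and J: "\<And>p. p \<in> seg_ball T (core M w) \<Longrightarrow> ident (emb w r l f p) = J p"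
  shows "online_view m ident (map (emb w r l f) us) T =
    (map J us, J ` seg_ball T (set us),
     {(J p, J q) | p q. p \<in> seg_ball T (set us) \<and> q \<in> seg_ball T (set us) \<and> seg_adj p q})"
proof -
  have sb: "seg_ball T (set us) \<subseteq> seg_ball T (core M w)" using us by (rule seg_ball_mono)
  have J': "ident (emb w r l f p) = J p" if "p \<in> seg_ball T (set us)" for p
    using J that sb by blast
  have "map ident (map (emb w r l f) us) = map J us"
    using us J core_subset_seg_ball by fastforce
  moreover have "ident ` emb w r l f ` seg_ball T (set us) = J ` seg_ball T (set us)"
    using J' by (force simp: image_image)
  moreover have "{(ident u, ident v) | u v. u \<in> emb w r l f ` seg_ball T (set us) \<and>
       v \<in> emb w r l f ` seg_ball T (set us) \<and> (u, v) \<in> grid_edges m} =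
     {(J p, J q) | p q. p \<in> seg_ball T (set us) \<and> q \<in> seg_ball T (set us) \<and> seg_adj p q}"
    (is "?L = ?R")
  proof (intro subset_antisym subsetI)
    fix z assume "z \<in> ?L"
    then obtain p q where "p \<in> seg_ball T (set us)" "q \<in> seg_ball T (set us)"
      "(emb w r l f p, emb w r l f q) \<in> grid_edges m" "z = (ident (emb w r l f p), ident (emb w r l f q))"
      by blast
    then show "z \<in> ?R" using emb_adj[OF v] J' sb by blast
  next
    fix z assume "z \<in> ?R"
    then obtain p q where *: "p \<in> seg_ball T (set us)" "q \<in> seg_ball T (set us)"
      "seg_adj p q" "z = (J p, J q)"
      by blast
    then have "(emb w r l f p, emb w r l f q) \<in> grid_edges m" using emb_adj[OF v] sb by blast
    moreover have "z = (ident (emb w r l f p), ident (emb w r l f q))" using * J' by simp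
    ultimately show "z \<in> ?L" using * by blast
  qed
  ultimately show ?thesis
    unfolding online_view_def Let_def set_map ball_emb[OF v us] by simp
qed

section \<open>Relocating what the algorithm has seen\<close>

lemma inj_on_extend:
  assumes "A \<subseteq> G" "finite G" "finite B" "card G \<le> card B" "inj_on f A" "f ` A \<subseteq> B"
  shows "\<exists>f'. inj_on f' G \<and> f' ` G \<subseteq> B \<and> (\<forall>x\<in>A. f' x = f x)"
proof -
  have fin: "finite A" using assms(1,2) by (rule finite_subset)
  have "card (G - A) \<le> card (B - f ` A)"
    using assms fin by (simp add: card_Diff_subset card_image)
  then obtain g where g: "inj_on g (G - A)" "g ` (G - A) \<subseteq> B - f ` A"
    using inj_on_iff_card_le[of "G - A" "B - f ` A"] assms(2,3) by blast
  define f' where "f' = (\<lambda>x. if x \<in> A then f x else g x)"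
  have "inj_on f' (A \<union> (G - A))"
  proof (rule inj_on_Un[THEN iffD2], intro conjI)
    show "inj_on f' A" using assms(5) by (auto simp: f'_def inj_on_def)
    show "inj_on f' (G - A)" using g(1) by (auto simp: f'_def inj_on_def)
    show "f' ` (A - (G - A)) \<inter> f' ` (G - A - A) = {}" using g(2) by (auto simp: f'_def)
  qed
  moreover have "A \<union> (G - A) = G" using assms(1) by auto
  moreover have "f' ` G \<subseteq> B" using assms(6) g(2) by (auto simp: f'_def)
  moreover have "\<forall>x\<in>A. f' x = f x" by (simp add: f'_def)
  ultimately show ?thesis by (intro exI[of _ f']) simp
qed

lemma grid_eq: "grid m = {..<m} \<times> {..<m}"
  by (auto simp: grid_def)

definition idents :: "nat \<Rightarrow> (node \<Rightarrow> nat) \<Rightarrow> bool" where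
  "idents m ident \<longleftrightarrow> inj_on ident (grid m) \<and> ident ` grid m \<subseteq> {1..m * m}"

text \<open>There are as many identifiers as nodes, so those left over after \<open>U\<close>
  suffice for the remaining nodes.\<close>

lemma idents_extend:
  assumes "U \<subseteq> grid m" "inj_on f U" "f ` U \<subseteq> {1..m * m}"
  shows "\<exists>ident. idents m ident \<and> (\<forall>u\<in>U. ident u = f u)"
  using inj_on_extend[OF assms(1) _ _ _ assms(2,3)] by (auto simp: idents_def grid_eq)

lemma online_coloring_nth:
  assumes "distinct \<sigma>" "i < length \<sigma>"
  shows "online_coloring A n T m ident \<sigma> (\<sigma> ! i) = A n (online_view m ident (take (Suc i) \<sigma>) T)"
proof -
  have "(THE i'. i' < length \<sigma> \<and> \<sigma> ! i' = \<sigma> ! i) = i"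
    using assms by (auto simp: nth_eq_iff_index_eq)
  then show ?thesis by (simp add: online_coloring_def)
qed

text \<open>Irrevocability: the color of a node is computed from the prefix ending at it, which
  later nodes do not alter.\<close>

lemma online_coloring_append:
  assumes "distinct (pre @ rest)" "v \<in> set pre"
  shows "online_coloring A n T m ident (pre @ rest) v = online_coloring A n T m ident pre v"
proof -
  obtain i where i: "i < length pre" "v = pre ! i" using assms(2) by (auto simp: in_set_conv_nth)
  then show ?thesis
    using online_coloring_nth[OF assms(1), of i A n T m ident]
      online_coloring_nth[of pre i A n T m ident] assms(1)
    by (simp add: nth_append)
qed

lemma relocate_idents:
  assumes v: "valid m T M w r l" and v': "valid m T M w r' l'" and ident: "idents m ident"
  shows "\<exists>ident'. idents m ident' \<and>
    (\<forall>p\<in>seg_ball T (core M w). ident' (emb w r' l' f' p) = ident (emb w r l f p))"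
proof -
  define S where "S = seg_ball T (core M w)"
  define J where "J = ident \<circ> emb w r l f"
  \<comment> \<open>Each node of a relocated ball inherits the identifier of its old position; the
    nodes outside these balls get leftover identifiers.\<close>
  define K where "K = J \<circ> inv_into S (emb w r' l' f')"
  have inj': "inj_on (emb w r' l' f') S" unfolding S_def using v' by (rule inj_on_emb)
  have sub: "emb w r l f ` S \<subseteq> grid m" unfolding S_def using emb_in_grid[OF v] by blast
  have "inj_on J S"
    unfolding J_def using inj_on_emb[OF v, of f] ident sub
    by (intro comp_inj_on) (auto simp: S_def idents_def intro: inj_on_subset)
  moreover have KJ: "K (emb w r' l' f' p) = J p" if "p \<in> S" for p
    using inv_into_f_f[OF inj' that] by (simp add: K_def)
  ultimately have "inj_on K (emb w r' l' f' ` S)"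
    by (auto simp: inj_on_def)
  moreover have "K ` (emb w r' l' f' ` S) \<subseteq> {1..m * m}"
    using KJ sub ident unfolding idents_def J_def by force
  moreover have "emb w r' l' f' ` S \<subseteq> grid m" unfolding S_def using emb_in_grid[OF v'] by blast
  ultimately obtain ident' where "idents m ident'" "\<forall>u\<in>emb w r' l' f' ` S. ident' u = K u"
    using idents_extend[of "emb w r' l' f' ` S" m K] by metis
  then show ?thesis using KJ unfolding S_def J_def by auto
qed

lemma online_coloring_emb:
  assumes v: "valid m T M w r l" and v': "valid m T M w r' l'"
    and ident': "\<forall>p\<in>seg_ball T (core M w). ident' (emb w r' l' f' p) = ident (emb w r l f p)"
    and us: "distinct us" "set us = core M w" and u: "u \<in> core M w"
  shows "online_coloring A n T m ident' (map (emb w r' l' f') us) (emb w r' l' f' u) =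
    online_coloring A n T m ident (map (emb w r l f) us) (emb w r l f u)"
proof -
  obtain i where i: "i < length us" "u = us ! i" using u us by (metis in_set_conv_nth)
  have d: "distinct (map (emb w r l f) us)" "distinct (map (emb w r' l' f') us)"
    using us inj_on_emb_core[OF v, of f] inj_on_emb_core[OF v', of f'] by (simp_all add: distinct_map)
  have sub: "set (take (Suc i) us) \<subseteq> core M w" using us set_take_subset by metis
  have "online_view m ident' (map (emb w r' l' f') (take (Suc i) us)) T =
      online_view m ident (map (emb w r l f) (take (Suc i) us)) T"
    using online_view_emb[OF v sub, of ident f "ident \<circ> emb w r l f"]
      online_view_emb[OF v' sub, of ident' f' "ident \<circ> emb w r l f"] ident' by simp
  then show ?thesis
    using online_coloring_nth[OF d(1), of i A n T m ident]
      online_coloring_nth[OF d(2), of i A n T m ident'] i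
    by (simp add: take_map)
qed

section \<open>A fixed algorithm against segments in uncommitted positions\<close>

locale grid_algorithm =
  fixes A :: "nat \<Rightarrow> view \<Rightarrow> nat" and m T :: nat
  assumes solves: "solves_grid_3col A (m * m) T"
begin

abbreviation coloring :: "(node \<Rightarrow> nat) \<Rightarrow> node list \<Rightarrow> node \<Rightarrow> nat" where
  "coloring \<equiv> online_coloring A (m * m) T m"

text \<open>A partial run can be continued to a full one, whose coloring is proper by correctness of
  the algorithm and keeps the colors already given.\<close>

lemma coloring_extend:
  assumes "idents m ident" "distinct pre" "set pre \<subseteq> grid m"
  shows "\<exists>c. (\<forall>v\<in>grid m. c v < 3) \<and> (\<forall>(u, v)\<in>grid_edges m. c u \<noteq> c v) \<and>
    (\<forall>v\<in>set pre. c v = coloring ident pre v)"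
proof -
  have "finite (grid m - set pre)" by (simp add: grid_eq)
  then obtain rest where rest: "set rest = grid m - set pre" "distinct rest"
    using finite_distinct_list by blast
  have d: "distinct (pre @ rest)" and s: "set (pre @ rest) = grid m"
    using assms rest by auto
  have "(\<forall>v\<in>grid m. coloring ident (pre @ rest) v < 3) \<and>
      (\<forall>(u, v)\<in>grid_edges m. coloring ident (pre @ rest) u \<noteq> coloring ident (pre @ rest) v)"
    using solves[unfolded solves_grid_3col_def Let_def, rule_format, of m ident "pre @ rest"]
      assms(1) d s by (simp add: idents_def)
  then show ?thesis
    using online_coloring_append[OF d] by (intro exI[of _ "coloring ident (pre @ rest)"]) simp
qed

text \<open>The colors \<open>\<kappa>\<close> are already forced on \<open>M\<close> segments of width \<open>w\<close>, while the adversary has not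
  yet committed to where these segments lie in the grid.\<close>

definition realizable :: "nat \<Rightarrow> int \<Rightarrow> (nat \<times> int \<times> int \<Rightarrow> nat) \<Rightarrow> bool" where
  "realizable M w \<kappa> \<longleftrightarrow> (\<exists>us. distinct us \<and> set us = core M w \<and>
     (\<forall>r l f. valid m T M w r l \<longrightarrow> (\<exists>ident. idents m ident \<and>
        (\<forall>u\<in>core M w. coloring ident (map (emb w r l f) us) (emb w r l f u) = \<kappa> u))))"

text \<open>One placement is enough: identifiers travel with the segments, so in any other placement
  the algorithm receives the same views and gives the same colors.\<close>

lemma realizableI:
  assumes v: "valid m T M w r l" and us: "distinct us" "set us = core M w"
    and ident: "idents m ident"
    and \<kappa>: "\<forall>u\<in>core M w. coloring ident (map (emb w r l f) us) (emb w r l f u) = \<kappa> u"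
  shows "realizable M w \<kappa>"
  unfolding realizable_def
proof (intro exI[of _ us] conjI us allI impI)
  fix r' l' f' assume v': "valid m T M w r' l'"
  obtain ident' where ident': "idents m ident'"
    "\<forall>p\<in>seg_ball T (core M w). ident' (emb w r' l' f' p) = ident (emb w r l f p)"
    using relocate_idents[OF v v' ident] by blast
  have "\<forall>u\<in>core M w. coloring ident' (map (emb w r' l' f') us) (emb w r' l' f' u) = \<kappa> u"
    using online_coloring_emb[OF v v' ident'(2) us] \<kappa> by simp
  then show "\<exists>ident. idents m ident \<and>
      (\<forall>u\<in>core M w. coloring ident (map (emb w r' l' f') us) (emb w r' l' f' u) = \<kappa> u)"
    using ident'(1) by blast
qed

lemma realizable_start:
  assumes v: "valid m T M w r l"
  shows "\<exists>\<kappa>. realizable M w \<kappa>"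
proof -
  obtain us where us: "set us = core M w" "distinct us"
    using finite_distinct_list[OF finite_core] by blast
  obtain ident where "idents m ident" using idents_extend[of "{}" m] by auto
  then show ?thesis
    using realizableI[OF v us(2,1), of ident "\<lambda>_. False"
        "\<lambda>u. coloring ident (map (emb w r l (\<lambda>_. False)) us) (emb w r l (\<lambda>_. False) u)"]
    by blast
qed

lemma realizable_coloring:
  assumes "realizable M w \<kappa>" and v: "valid m T M w r l"
  shows "\<exists>c. (\<forall>v\<in>grid m. c v < 3) \<and> (\<forall>(u, v)\<in>grid_edges m. c u \<noteq> c v) \<and>
    (\<forall>u\<in>core M w. c (emb w r l f u) = \<kappa> u)"
proof -
  obtain us ident where us: "distinct us" "set us = core M w" and ident: "idents m ident"
    and \<kappa>: "\<forall>u\<in>core M w. coloring ident (map (emb w r l f) us) (emb w r l f u) = \<kappa> u"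
    using assms unfolding realizable_def by metis
  have "distinct (map (emb w r l f) us)" "set (map (emb w r l f) us) \<subseteq> grid m"
    using us inj_on_emb_core[OF v, of f] emb_core_in_grid[OF v, of f] by (simp_all add: distinct_map)
  then obtain c where "\<forall>v\<in>grid m. c v < 3" "\<forall>(u, v)\<in>grid_edges m. c u \<noteq> c v"
    "\<forall>v\<in>set (map (emb w r l f) us). c v = coloring ident (map (emb w r l f) us) v"
    using coloring_extend[OF ident] by metis
  then show ?thesis using \<kappa> us by (intro exI[of _ c]) simp
qed

text \<open>The adversary fixes relative positions of old segments by covering them with new ones.
  It presents the missing nodes of the new segments after the old ones, whose colors persist; the
  positions of the new segments are then free again.\<close>

lemma realizable_extend:
  assumes "realizable M w \<kappa>" and v: "valid m T M w r l" and v': "valid m T M' w' r' l'"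
    and sub: "emb w r l f ` core M w \<subseteq> emb w' r' l' f' ` core M' w'"
  shows "\<exists>\<kappa>'. realizable M' w' \<kappa>' \<and>
    (\<forall>u\<in>core M w. \<forall>u'\<in>core M' w'. emb w r l f u = emb w' r' l' f' u' \<longrightarrow> \<kappa>' u' = \<kappa> u)"
proof -
  obtain us ident where us: "distinct us" "set us = core M w" and ident: "idents m ident"
    and \<kappa>: "\<forall>u\<in>core M w. coloring ident (map (emb w r l f) us) (emb w r l f u) = \<kappa> u"
    using assms(1) v unfolding realizable_def by metis
  define pre where "pre = map (emb w r l f) us"
  have pre: "distinct pre" "set pre = emb w r l f ` core M w"
    using us inj_on_emb_core[OF v, of f] by (simp_all add: pre_def distinct_map)
  have "finite (emb w' r' l' f' ` core M' w' - set pre)" by (simp add: finite_core)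
  from finite_distinct_list[OF this] obtain rest
    where rest: "set rest = emb w' r' l' f' ` core M' w' - set pre" "distinct rest"
    by blast
  have d: "distinct (pre @ rest)" and s: "set (pre @ rest) = emb w' r' l' f' ` core M' w'"
    using pre rest sub by auto
  \<comment> \<open>The presentation order, pulled back to offsets in the new segments.\<close>
  define us' where "us' = map (inv_into (core M' w') (emb w' r' l' f')) (pre @ rest)"
  have m': "map (emb w' r' l' f') us' = pre @ rest"
    unfolding us'_def map_map using s by (intro map_idI) (simp add: f_inv_into_f)
  have inj': "inj_on (emb w' r' l' f') (core M' w')" using v' by (rule inj_on_emb_core)
  have us': "distinct us'" using d m' by (metis distinct_map)
  have "set us' = inv_into (core M' w') (emb w' r' l' f') ` emb w' r' l' f' ` core M' w'"
    unfolding us'_def by (simp only: set_map s)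
  then have "set us' = core M' w'" using inv_into_image_cancel[OF inj' subset_refl] by simp
  then have "realizable M' w' (\<lambda>u. coloring ident (pre @ rest) (emb w' r' l' f' u))"
    using realizableI[OF v' us' _ ident, of f'] unfolding m' by simp
  moreover have "coloring ident (pre @ rest) (emb w' r' l' f' u') = \<kappa> u"
    if "u \<in> core M w" "emb w r l f u = emb w' r' l' f' u'" for u u'
  proof -
    have "emb w' r' l' f' u' \<in> set pre" using that pre by (metis imageI)
    then have "coloring ident (pre @ rest) (emb w' r' l' f' u') = coloring ident pre (emb w r l f u)"
      using online_coloring_append[OF d] that by simp
    then show ?thesis using \<kappa> that(1) unfolding pre_def by simp
  qed
  ultimately show ?thesis by (intro exI conjI) auto
qed

lemma realizable_is_height:
  assumes "realizable M w \<kappa>" and v: "valid m T M w r l" and i: "i < M"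
  shows "\<exists>h. is_height (\<lambda>t. \<kappa> (i, t, 0)) h 0 (w - 1)"
proof -
  define e where "e = emb w r l (\<lambda>_. False)"
  obtain c where c: "\<forall>v\<in>grid m. c v < 3" "\<forall>(u, v)\<in>grid_edges m. c u \<noteq> c v"
    "\<forall>u\<in>core M w. c (e u) = \<kappa> u"
    using realizable_coloring[OF assms(1) v, of "\<lambda>_. False"] unfolding e_def by metis
  show ?thesis
  proof (rule is_height_exists; intro ballI)
    fix t assume "t \<in> {0..w - 1}"
    then have "(i, t, 0) \<in> core M w" using i by (simp add: core_def)
    then show "\<kappa> (i, t, 0) < 3"
      using c(1,3) emb_core_in_grid[OF v, of "\<lambda>_. False"] unfolding e_def by fastforce
  next
    fix t assume "t \<in> {0..<w - 1}"
    then have *: "(i, t, 0) \<in> core M w" "(i, t + 1, 0) \<in> core M w" using i by (simp_all add: core_def)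
    then have "(i, t, 0) \<in> seg_ball T (core M w)" "(i, t + 1, 0) \<in> seg_ball T (core M w)"
      using core_subset_seg_ball by blast+
    then have "(e (i, t, 0), e (i, t + 1, 0)) \<in> grid_edges m"
      unfolding e_def using emb_adj[OF v] by (simp add: seg_adj_def)
    then have "c (e (i, t, 0)) \<noteq> c (e (i, t + 1, 0))" using c(2) by blast
    then show "\<kappa> (i, t, 0) \<noteq> \<kappa> (i, t + 1, 0)" using c(3) * by simp
  qed
qed

end

section \<open>Merging segments\<close>

text \<open>Induction over the rows, each contributing at most 2 by
  \<open>is_height_adjacent\<close>.\<close>

lemma height_rows_diff:
  assumes H: "\<forall>x<m. is_height (\<lambda>t. c (x, nat t)) (H x) 0 (int m - 1)"
    and c: "\<forall>(u, v)\<in>grid_edges m. c u \<noteq> c v"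
    and ab: "a \<in> {0..int m - 1}" "b \<in> {0..int m - 1}" and xy: "x \<le> y" "y < m"
  shows "\<bar>(H x b - H x a) - (H y b - H y a)\<bar> \<le> 2 * int (y - x)"
  using xy
proof (induction y rule: dec_induct)
  case base
  then show ?case by simp
next
  case (step y)
  have "c (y, nat t) \<noteq> c (Suc y, nat t)" if "t \<in> {0..int m - 1}" for t
  proof -
    have "((y, nat t), (Suc y, nat t)) \<in> grid_edges m"
      using that step.prems by (auto simp: grid_edges_def grid_def)
    then show ?thesis using c by blast
  qed
  then have "\<bar>(H y b - H y a) - (H (Suc y) b - H (Suc y) a)\<bar> \<le> 2"
    using is_height_adjacent[OF H[rule_format, of y] H[rule_format, of "Suc y"] _ ab] step.prems
    by simp
  moreover have "\<bar>(H x b - H x a) - (H y b - H y a)\<bar> \<le> 2 * int (y - x)"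
    using step by simp
  moreover have "int (Suc y - x) = int (y - x) + 1" using step.hyps by simp
  ultimately show ?case by linarith
qed

text \<open>Rows at spacing \<open>2 T + 2\<close>, starting at \<open>T\<close>: the densest choice
  for which the \<open>T\<close>-balls around nodes of different rows neither meet nor touch, and
  none is cut off at the first row of the grid.\<close>

definition slot :: "nat \<Rightarrow> nat \<Rightarrow> int" where
  "slot T k = int T + int k * (2 * int T + 2)"

lemma slot_upper:
  assumes "k < K" "K * (2 * T + 2) \<le> m"
  shows "slot T k + int T < int m"
proof -
  have "Suc k * (2 * T + 2) \<le> K * (2 * T + 2)" using assms(1) by (intro mult_right_mono) auto
  then have "Suc k * (2 * T + 2) \<le> m" using assms(2) by linarith
  then have "int (Suc k * (2 * T + 2)) \<le> int m" by (simp only: of_nat_le_iff)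
  then show ?thesis by (simp add: slot_def algebra_simps)
qed

lemma slot_diff:
  assumes "k \<noteq> k'"
  shows "\<bar>slot T k - slot T k'\<bar> \<ge> 2 * int T + 2"
proof -
  have "slot T k - slot T k' = (int k - int k') * (2 * int T + 2)"
    by (simp add: slot_def algebra_simps)
  then have "\<bar>slot T k - slot T k'\<bar> = \<bar>int k - int k'\<bar> * (2 * int T + 2)"
    by (simp add: abs_mult)
  moreover have "1 * (2 * int T + 2) \<le> \<bar>int k - int k'\<bar> * (2 * int T + 2)"
    using assms by (intro mult_right_mono) auto
  ultimately show ?thesis by simp
qed

text \<open>Different slots are far enough apart vertically, so only segments in a common slot need
  a horizontal gap.\<close>

lemma valid_slots:
  assumes K: "\<forall>i<M. s i < K" "K * (2 * T + 2) \<le> m"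
    and l: "\<forall>i<M. int T \<le> l i \<and> l i + w + int T \<le> int m"
    and sep: "\<forall>i<M. \<forall>i'<M. i \<noteq> i' \<longrightarrow> s i = s i' \<longrightarrow>
        l i + w + 2 * int T + 1 \<le> l i' \<or> l i' + w + 2 * int T + 1 \<le> l i"
  shows "valid m T M w (\<lambda>i. slot T (s i)) l"
proof -
  have "int T \<le> slot T (s i)" for i by (simp add: slot_def)
  then show ?thesis
    unfolding valid_def using slot_upper[OF _ K(2)] slot_diff K(1) l sep by metis
qed

text \<open>A lower bound on the oscillation of the height: \<open>a\<close> is a low and
  \<open>b\<close> a high point, in either order along the segment.\<close>

definition varies :: "(nat \<times> int \<times> int \<Rightarrow> nat) \<Rightarrow> int \<Rightarrow> int \<Rightarrow> nat \<Rightarrow> bool" where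
  "varies \<kappa> w k i \<longleftrightarrow> (\<exists>h a b. is_height (\<lambda>t. \<kappa> (i, t, 0)) h 0 (w - 1) \<and>
     a \<in> {0..w - 1} \<and> b \<in> {0..w - 1} \<and> k \<le> h b - h a)"

section \<open>Rounds of merging, the final collision and the choice of parameters\<close>

context grid_algorithm
begin

text \<open>Two segments are put into the same row such that their high points are at an odd distance.
  Then the heights of these points differ, and the higher one exceeds the low point of the other
  segment by at least \<open>k + 1\<close>.\<close>

lemma realizable_merge:
  assumes real: "realizable (2 * M) w \<kappa>" and k: "\<forall>i<2 * M. varies \<kappa> w k i"
    and m: "2 * M * (2 * T + 2) \<le> m" "2 * w + 4 * int T + 2 \<le> int m"
  shows "\<exists>\<kappa>'. realizable M (2 * w + 2 * int T + 2) \<kappa>' \<and>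
    (\<forall>p<M. varies \<kappa>' (2 * w + 2 * int T + 2) (k + 1) p)"
proof -
  obtain H a b where H: "\<And>i. i < 2 * M \<Longrightarrow> is_height (\<lambda>t. \<kappa> (i, t, 0)) (H i) 0 (w - 1)"
    and ab: "\<And>i. i < 2 * M \<Longrightarrow> a i \<in> {0..w - 1}" "\<And>i. i < 2 * M \<Longrightarrow> b i \<in> {0..w - 1}"
    and k: "\<And>i. i < 2 * M \<Longrightarrow> k \<le> H i (b i) - H i (a i)"
    using k unfolding varies_def by metis
  define w' where "w' = 2 * w + 2 * int T + 2"
  \<comment> \<open>The gap between the segments \<open>2 p\<close> and \<open>2 p + 1\<close>. The
    least gap that \<open>valid\<close> allows is \<open>2 T + 1\<close>; one more column is
    inserted if the high points would otherwise be at even distance. The width \<open>w'\<close>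
    leaves room for either gap.\<close>
  define g where "g = (\<lambda>p. if even (b (2 * p + 1) + w - b (2 * p)) then 2 * int T + 1 else 2 * int T + 2)"
  define d where "d = (\<lambda>i. if even i then 0 else w + g (i div 2))"
  define r where "r = (\<lambda>i. slot T (i div 2))"
  define l where "l = (\<lambda>i. int T + d i)"
  define r' where "r' = (\<lambda>i. slot T i)"
  define l' where "l' = (\<lambda>i::nat. int T)"
  define F where "F = (\<lambda>i::nat. False)"
  have g: "2 * int T + 1 \<le> g p" "g p \<le> 2 * int T + 2" for p by (simp_all add: g_def)
  show ?thesis
  proof (cases "M = 0")
    case True
    then show ?thesis using real by (auto simp: realizable_def core_def valid_def)
  next
    case False
    then have w: "w > 0" using ab(1)[of 0] by simp
    have dw: "0 \<le> d i" "d i + w \<le> w'" for i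
      using g[of "i div 2"] w by (simp_all add: d_def w'_def)
    have v: "valid m T (2 * M) w r l" unfolding r_def
    proof (rule valid_slots[of _ _ M])
      show "\<forall>i<2 * M. i div 2 < M" by auto
      show "M * (2 * T + 2) \<le> m" using m(1) by (auto simp: algebra_simps)
      show "\<forall>i<2 * M. int T \<le> l i \<and> l i + w + int T \<le> int m"
        using dw m(2) unfolding l_def w'_def by (smt (verit))
      show "\<forall>i<2 * M. \<forall>i'<2 * M. i \<noteq> i' \<longrightarrow> i div 2 = i' div 2 \<longrightarrow>
          l i + w + 2 * int T + 1 \<le> l i' \<or> l i' + w + 2 * int T + 1 \<le> l i"
      proof (intro allI impI)
        fix i i' :: nat assume "i \<noteq> i'" "i div 2 = i' div 2"
        then have "even i \<noteq> even i'" by (metis even_two_times_div_two odd_two_times_div_two_succ)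
        then show "l i + w + 2 * int T + 1 \<le> l i' \<or> l i' + w + 2 * int T + 1 \<le> l i"
          using g(1)[of "i div 2"] g(1)[of "i' div 2"] by (auto simp: l_def d_def)
      qed
    qed
    have v': "valid m T M w' r' l'" unfolding r'_def
    proof (rule valid_slots[of _ _ M])
      show "M * (2 * T + 2) \<le> m" using m(1) by (auto simp: algebra_simps)
      show "\<forall>i<M. int T \<le> l' i \<and> l' i + w' + int T \<le> int m"
        using m(2) by (simp add: l'_def w'_def)
    qed auto
    \<comment> \<open>The same grid node, addressed once in the old segment \<open>i\<close> and
      once in the merged segment \<open>i div 2\<close>.\<close>
    have e: "emb w r l F (i, t, y) = emb w' r' l' F (i div 2, t + d i, y)" for i t y
      by (simp add: emb_def r_def l_def r'_def l'_def F_def algebra_simps)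
    have c: "(i div 2, t + d i, 0) \<in> core M w'" if "(i, t, y) \<in> core (2 * M) w" for i t y
      using that dw[of i] by (auto simp: core_def)
    have "emb w r l F u \<in> emb w' r' l' F ` core M w'" if u: "u \<in> core (2 * M) w" for u
    proof -
      obtain i t y where uu: "u = (i, t, y)" by (cases u)
      have "y = 0" using u uu by (simp add: core_def)
      then show ?thesis using c[of i t y] u unfolding uu e by blast
    qed
    then have sub: "emb w r l F ` core (2 * M) w \<subseteq> emb w' r' l' F ` core M w'" by blast
    obtain \<kappa>' where real': "realizable M w' \<kappa>'"
      and \<kappa>': "\<forall>u\<in>core (2 * M) w. \<forall>u'\<in>core M w'. emb w r l F u = emb w' r' l' F u' \<longrightarrow> \<kappa>' u' = \<kappa> u"
      using realizable_extend[OF real v v' sub] by blast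
    have \<kappa>\<kappa>': "\<kappa>' (i div 2, t + d i, 0) = \<kappa> (i, t, 0)" if "i < 2 * M" "t \<in> {0..w - 1}" for i t
    proof -
      have "(i, t, 0) \<in> core (2 * M) w" using that by (simp add: core_def)
      then show ?thesis using \<kappa>' c e by blast
    qed
    have "varies \<kappa>' w' (k + 1) p" if p: "p < M" for p
    proof -
      obtain h where h: "is_height (\<lambda>t. \<kappa>' (p, t, 0)) h 0 (w' - 1)"
        using realizable_is_height[OF real' v' p] by blast
      \<comment> \<open>On the window of the old segment \<open>i\<close>, the new height lifts the
        old colors, so the old rise persists by uniqueness.\<close>
      have *: "h (b i + d i) - h (a i + d i) \<ge> k" if i: "i < 2 * M" "i div 2 = p" for i
      proof -
        have "is_height (\<lambda>t. \<kappa>' (p, t, 0)) h (0 + d i) (w - 1 + d i)"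
          using dw[of i] by (intro is_height_sub[OF h]) auto
        then have "is_height (\<lambda>t. \<kappa>' (p, t + d i, 0)) (\<lambda>t. h (t + d i)) 0 (w - 1)"
          by (rule is_height_shift)
        then have "is_height (\<lambda>t. \<kappa> (i, t, 0)) (\<lambda>t. h (t + d i)) 0 (w - 1)"
          by (rule is_height_cong) (use \<kappa>\<kappa>'[OF i(1)] i(2) in simp)
        then show ?thesis
          using is_height_unique[OF _ H[OF i(1)] ab(1)[OF i(1)] ab(2)[OF i(1)]] k[OF i(1)] by fastforce
      qed
      define i j where "i = 2 * p" and "j = 2 * p + 1"
      have ij: "i < 2 * M" "i div 2 = p" "j < 2 * M" "j div 2 = p"
        using p by (auto simp: i_def j_def)
      have in_range: "a q + d q \<in> {0..w' - 1}" "b q + d q \<in> {0..w' - 1}" if "q < 2 * M" for q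
        using ab[OF that] dw[of q] by auto
      have "odd ((b j + d j) - (b i + d i))" by (auto simp: i_def j_def d_def g_def)
      then have "odd (h (b j + d j) - h (b i + d i))"
        using in_range ij by (intro is_height_odd[OF h]) auto
      then have "h (b j + d j) \<noteq> h (b i + d i)" by auto
      then consider "h (b j + d j) \<ge> h (b i + d i) + 1" | "h (b i + d i) \<ge> h (b j + d j) + 1"
        by linarith
      then show ?thesis
      proof cases
        case 1
        then have "k + 1 \<le> h (b j + d j) - h (a i + d i)" using *[of i] ij by simp
        then show ?thesis unfolding varies_def using h in_range ij by blast
      next
        case 2
        then have "k + 1 \<le> h (b i + d i) - h (a j + d j)" using *[of j] ij by simp
        then show ?thesis unfolding varies_def using h in_range ij by blast
      qed
    qed
    then show ?thesis using real' unfolding w'_def by blast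
  qed
qed

text \<open>By pigeonhole, two of more than \<open>w * w\<close> segments share their low and high
  offsets. One goes into row \<open>T\<close>, the other reversed into row \<open>3 T + 2\<close>,
  with the low point of each in the column of the high point of the other. The rises between these
  columns differ by at least \<open>4 T + 6\<close>, but rows at distance \<open>2 T + 2\<close>
  allow only \<open>4 T + 4\<close>.\<close>

lemma realizable_varies_False:
  assumes real: "realizable M w \<kappa>" and k: "\<forall>i<M. varies \<kappa> w (2 * int T + 3) i"
    and M: "nat w * nat w < M"
    and m: "(M + 2) * (2 * T + 2) \<le> m" "3 * w + 2 * int T \<le> int m"
  shows False
proof -
  obtain H a b where H: "\<And>i. i < M \<Longrightarrow> is_height (\<lambda>t. \<kappa> (i, t, 0)) (H i) 0 (w - 1)"
    and ab: "\<And>i. i < M \<Longrightarrow> a i \<in> {0..w - 1}" "\<And>i. i < M \<Longrightarrow> b i \<in> {0..w - 1}"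
    and k: "\<And>i. i < M \<Longrightarrow> 2 * int T + 3 \<le> H i (b i) - H i (a i)"
    using k unfolding varies_def by metis
  have "\<not> inj_on (\<lambda>i. (a i, b i)) {..<M}"
  proof
    assume "inj_on (\<lambda>i. (a i, b i)) {..<M}"
    then have "card {..<M} \<le> card ({0..w - 1} \<times> {0..w - 1})"
      by (rule card_inj_on_le) (use ab in auto)
    then show False using M by (simp add: card_cartesian_product)
  qed
  then obtain i j where ij: "i < M" "j < M" "i \<noteq> j" "a i = a j" "b i = b j"
    by (auto simp: inj_on_def)
  have a: "0 \<le> a i" "a i < w" and b: "0 \<le> b i" "b i < w" using ab ij by auto
  \<comment> \<open>Slots 0 and 1 go to \<open>i\<close> and \<open>j\<close>; all others move up by
    2, whence the \<open>M + 2\<close> slots.\<close>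
  define s where "s = (\<lambda>q. if q = i then 0 else if q = j then 1 else q + 2)"
  \<comment> \<open>Reversed, segment \<open>j\<close> has its offset \<open>t\<close> in column
    \<open>T + w + a i + b i - t\<close>. So its offset \<open>a i\<close> meets the offset
    \<open>b i\<close> of segment \<open>i\<close>, and vice versa. Starting \<open>i\<close> at
    \<open>T + w\<close> keeps \<open>j\<close> clear of the left margin for all \<open>a i\<close>
    and \<open>b i\<close>.\<close>
  define l where "l = (\<lambda>q. if q = i then int T + w else if q = j then int T + a i + b i + 1 else int T)"
  define f where "f = (\<lambda>q. q = j)"
  have v: "valid m T M w (\<lambda>q. slot T (s q)) l"
  proof (rule valid_slots[of _ _ "M + 2"])
    show "\<forall>q<M. s q < M + 2" by (simp add: s_def)
    show "\<forall>q<M. int T \<le> l q \<and> l q + w + int T \<le> int m" using a b m(2) by (simp add: l_def)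
    show "\<forall>q<M. \<forall>q'<M. q \<noteq> q' \<longrightarrow> s q = s q' \<longrightarrow>
        l q + w + 2 * int T + 1 \<le> l q' \<or> l q' + w + 2 * int T + 1 \<le> l q"
      by (simp add: s_def)
  qed (rule m(1))
  obtain c where c: "\<forall>v\<in>grid m. c v < 3" "\<forall>(u, v)\<in>grid_edges m. c u \<noteq> c v"
    "\<forall>u\<in>core M w. c (emb w (\<lambda>q. slot T (s q)) l f u) = \<kappa> u"
    using realizable_coloring[OF real v, of f] by metis
  have "\<exists>h. is_height (\<lambda>t. c (x, nat t)) h 0 (int m - 1)" if "x < m" for x
  proof (rule is_height_exists; intro ballI)
    fix t assume "t \<in> {0..int m - 1}"
    then have "(x, nat t) \<in> grid m" using that by (auto simp: grid_def)
    then show "c (x, nat t) < 3" using c(1) by blast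
  next
    fix t assume "t \<in> {0..<int m - 1}"
    then have "((x, nat t), (x, nat (t + 1))) \<in> grid_edges m"
      using that by (auto simp: grid_edges_def grid_def)
    then show "c (x, nat t) \<noteq> c (x, nat (t + 1))" using c(2) by blast
  qed
  then obtain G where G: "\<forall>x<m. is_height (\<lambda>t. c (x, nat t)) (G x) 0 (int m - 1)" by metis
  define x where "x = T"
  define y where "y = 3 * T + 2"
  have "2 * (2 * T + 2) \<le> (M + 2) * (2 * T + 2)" by (rule mult_right_mono) auto
  then have "2 * (2 * T + 2) \<le> m" using m(1) by linarith
  then have xy: "x \<le> y" "x < m" "y < m" by (simp_all add: x_def y_def)
  define A where "A = int T + w + a i"
  define B where "B = int T + w + b i"
  have "is_height (\<lambda>t. c (x, nat t)) (G x) (0 + (int T + w)) (w - 1 + (int T + w))"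
    using m(2) a by (intro is_height_sub[OF G[rule_format, OF xy(2)]]) simp_all
  then have "is_height (\<lambda>t. c (x, nat (t + (int T + w)))) (\<lambda>t. G x (t + (int T + w))) 0 (w - 1)"
    by (rule is_height_shift)
  moreover have "c (x, nat (t + (int T + w))) = \<kappa> (i, t, 0)" if "t \<in> {0..w - 1}" for t
    using c(3)[rule_format, of "(i, t, 0)"] that ij
    by (simp add: core_def emb_def slot_def s_def l_def f_def x_def algebra_simps)
  ultimately have "is_height (\<lambda>t. \<kappa> (i, t, 0)) (\<lambda>t. G x (t + (int T + w))) 0 (w - 1)"
    by (rule is_height_cong)
  from is_height_unique[OF this H[OF ij(1)] ab(1)[OF ij(1)] ab(2)[OF ij(1)]]
  have 1: "G x B - G x A \<ge> 2 * int T + 3"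
    using k[OF ij(1)] by (simp add: A_def B_def algebra_simps)
  \<comment> \<open>Offset \<open>t\<close> of the reversed segment lies in column
    \<open>C - t\<close>; in particular \<open>A = C - b i\<close> and
    \<open>B = C - a i\<close>.\<close>
  define C where "C = int T + a i + b i + w"
  have "is_height (\<lambda>t. c (y, nat t)) (G y) (C - (w - 1)) (C - 0)"
    using m(2) a b by (intro is_height_sub[OF G[rule_format, OF xy(3)]]) (simp_all add: C_def)
  then have "is_height (\<lambda>t. c (y, nat (C - t))) (\<lambda>t. G y (C - t)) 0 (w - 1)"
    by (rule is_height_reflect)
  moreover have "c (y, nat (C - t)) = \<kappa> (j, t, 0)" if "t \<in> {0..w - 1}" for t
  proof -
    have "emb w (\<lambda>q. slot T (s q)) l f (j, t, 0) = (y, nat (C - t))"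
      using ij(3) by (simp add: emb_def slot_def s_def l_def f_def y_def C_def nat_eq_iff algebra_simps)
    then show ?thesis using c(3)[rule_format, of "(j, t, 0)"] that ij by (simp add: core_def)
  qed
  ultimately have "is_height (\<lambda>t. \<kappa> (j, t, 0)) (\<lambda>t. G y (C - t)) 0 (w - 1)"
    by (rule is_height_cong)
  from is_height_unique[OF this H[OF ij(2)] ab(1)[OF ij(2)] ab(2)[OF ij(2)]]
  have 2: "G y A - G y B \<ge> 2 * int T + 3"
    using k[OF ij(2)] ij(4,5) by (simp add: A_def B_def C_def algebra_simps)
  have "\<bar>(G x B - G x A) - (G y B - G y A)\<bar> \<le> 2 * int (y - x)"
    using a b m(2) by (intro height_rows_diff[OF G c(2) _ _ xy(1,3)]) (auto simp: A_def B_def)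
  then show False using 1 2 by (simp add: x_def y_def)
qed

text \<open>Starting from \<open>M * 2 ^ k\<close> single nodes with variation 0, each round halves
  the number of segments and gains 1 in variation. The width solves the recursion
  \<open>W (Suc j) = 2 * W j + 2 * T + 2\<close> with \<open>W 0 = 1\<close>.\<close>

lemma realizable_iterate:
  assumes m: "M * 2 ^ k * (2 * T + 2) \<le> m" "2 ^ k * (2 * T + 3) + 2 * T \<le> m" and j: "j \<le> k"
  shows "\<exists>\<kappa>. realizable (M * 2 ^ (k - j)) (2 ^ j * (2 * int T + 3) - (2 * int T + 2)) \<kappa> \<and>
    (\<forall>i<M * 2 ^ (k - j). varies \<kappa> (2 ^ j * (2 * int T + 3) - (2 * int T + 2)) (int j) i)"
  using j
proof (induction j)
  case 0
  have "1 * (2 * T + 3) \<le> 2 ^ k * (2 * T + 3)" by (intro mult_right_mono) auto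
  then have "1 * (2 * T + 3) \<le> m" using add_leD1[OF m(2)] by (rule order_trans)
  then have "2 * T + 1 \<le> m" by simp
  then have v: "valid m T (M * 2 ^ k) 1 (\<lambda>i. slot T i) (\<lambda>i. int T)"
    using m(1) by (intro valid_slots[of _ _ "M * 2 ^ k"]) auto
  then obtain \<kappa> where \<kappa>: "realizable (M * 2 ^ k) 1 \<kappa>" using realizable_start by blast
  have "varies \<kappa> 1 0 i" if "i < M * 2 ^ k" for i
    using realizable_is_height[OF \<kappa> v that] by (auto simp: varies_def)
  then show ?case using \<kappa> by auto
next
  case (Suc j)
  define W where "W = (\<lambda>j::nat. 2 ^ j * (2 * int T + 3) - (2 * int T + 2))"
  have Wj: "2 ^ j * (2 * int T + 3) - (2 * int T + 2) = W j" for j by (simp add: W_def)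
  have W: "W (Suc j) = 2 * W j + 2 * int T + 2" by (simp add: W_def algebra_simps)
  have M: "M * 2 ^ (k - j) = 2 * (M * 2 ^ (k - Suc j))"
    using Suc.prems by (simp add: Suc_diff_Suc[symmetric])
  obtain \<kappa> where \<kappa>: "realizable (2 * (M * 2 ^ (k - Suc j))) (W j) \<kappa>"
    "\<forall>i<2 * (M * 2 ^ (k - Suc j)). varies \<kappa> (W j) (int j) i"
    using Suc.IH Suc.prems unfolding M Wj by auto
  have "M * 2 ^ (k - j) * (2 * T + 2) \<le> M * 2 ^ k * (2 * T + 2)"
    by (intro mult_right_mono mult_left_mono power_increasing) auto
  then have 1: "2 * (M * 2 ^ (k - Suc j)) * (2 * T + 2) \<le> m" using m(1) unfolding M by linarith
  have "int (2 ^ Suc j * (2 * T + 3)) \<le> int (2 ^ k * (2 * T + 3))"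
    unfolding of_nat_le_iff using Suc.prems by (intro mult_right_mono power_increasing) auto
  moreover have "int (2 ^ k * (2 * T + 3) + 2 * T) \<le> int m" using m(2) by (simp only: of_nat_le_iff)
  moreover have "2 * W j + 4 * int T + 2 = int (2 ^ Suc j * (2 * T + 3)) - 2"
    by (simp add: W_def algebra_simps)
  ultimately have 2: "2 * W j + 4 * int T + 2 \<le> int m" by linarith
  show ?case
    using realizable_merge[OF \<kappa> 1 2] unfolding Wj W[symmetric] by (simp add: add.commute)
qed

text \<open>With \<open>P = 2 ^ (2 * T + 3)\<close>, the final width is at most
  \<open>P ^ 2\<close>, so about \<open>P ^ 4\<close> final segments suffice for the pigeonhole. The
  initial segments are \<open>P\<close> times as many and use \<open>2 T + 2\<close>, at most
  \<open>P\<close>, rows each. The seventh factor \<open>P\<close> absorbs the constants.\<close>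

lemma grid_side_less: "m < 2 ^ (7 * (2 * T + 3))"
proof (rule ccontr)
  assume "\<not> ?thesis"
  then have m: "2 ^ (7 * (2 * T + 3)) \<le> m" by simp
  \<comment> \<open>As many rounds as the variation required for the contradiction.\<close>
  define k where "k = 2 * T + 3"
  define P :: nat where "P = 2 ^ k"
  then have m: "P ^ 7 \<le> m" using m by (simp only: k_def power_mult[symmetric] mult.commute)
  have kP: "k < P" unfolding P_def by (rule less_exp)
  have "2 ^ 3 \<le> P" unfolding P_def k_def by (intro power_increasing) auto
  then have P: "8 \<le> P" by simp
  define w where "w = P * k - (2 * T + 2)"
  have wP: "w \<le> P * P" and w_int: "int w = 2 ^ k * (2 * int T + 3) - (2 * int T + 2)"
  proof -
    have "P * k \<le> P * P" using kP by simp
    then show "w \<le> P * P" unfolding w_def by linarith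
    have "1 * k \<le> P * k" using P by (intro mult_right_mono) auto
    moreover have "2 * T + 2 \<le> k" by (simp add: k_def)
    ultimately have "2 * T + 2 \<le> P * k" by linarith
    then have "int w = int P * int k - int (2 * T + 2)" by (simp add: w_def of_nat_diff)
    then show "int w = 2 ^ k * (2 * int T + 3) - (2 * int T + 2)" by (simp add: P_def k_def)
  qed
  \<comment> \<open>One more than the number of pairs of offsets.\<close>
  define M where "M = w * w + 1"
  have MP: "M + 2 \<le> 2 * P ^ 4"
  proof -
    have "w * w \<le> (P * P) * (P * P)" using wP by (intro mult_mono) auto
    moreover have "8 ^ 4 \<le> P ^ 4" using P by (intro power_mono) auto
    ultimately show ?thesis by (simp add: M_def power4_eq_xxxx)
  qed
  have "2 * P ^ 6 \<le> P * P ^ 6" using P by (intro mult_right_mono) auto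
  then have P7: "2 * P ^ 6 \<le> P ^ 7" by (simp flip: power_Suc)
  have TP: "2 * T + 3 \<le> P" using kP by (simp add: k_def)
  have "M * 2 ^ k * (2 * T + 2) \<le> (2 * P ^ 4) * P * P"
    unfolding P_def[symmetric] using MP TP by (intro mult_mono) auto
  also have P6: "\<dots> = 2 * P ^ 6" by (simp add: eval_nat_numeral algebra_simps)
  finally have 1: "M * 2 ^ k * (2 * T + 2) \<le> m" using P7 m by linarith
  have "(M + 2) * (2 * T + 2) \<le> (M + 2) * P" using TP by (intro mult_left_mono) auto
  also have "\<dots> \<le> 2 * P ^ 4 * P" using MP by (rule mult_right_mono) simp
  also have "\<dots> \<le> 2 * P ^ 4 * P * P" using P by simp
  also note P6
  finally have 2: "(M + 2) * (2 * T + 2) \<le> m" using P7 m by linarith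
  have "P * P * 8 \<le> P * P * P ^ 5"
    using P self_le_power[of P 5] by (intro mult_left_mono) auto
  moreover have "P * P * P ^ 5 = P ^ 7" by (simp add: eval_nat_numeral)
  ultimately have PP: "8 * (P * P) \<le> m" using m by linarith
  have "P \<le> P * P" using P by simp
  then have TPP: "2 * T \<le> P * P" using TP by linarith
  have "2 ^ k * (2 * T + 3) \<le> P * P"
    unfolding P_def[symmetric] using TP by (rule mult_left_mono) simp
  then have 3: "2 ^ k * (2 * T + 3) + 2 * T \<le> m" using TPP PP by linarith
  have "3 * w + 2 * T \<le> m" using wP TPP PP by linarith
  then have 4: "3 * int w + 2 * int T \<le> int m" by linarith
  obtain \<kappa> where "realizable M (int w) \<kappa>" "\<forall>i<M. varies \<kappa> (int w) (2 * int T + 3) i"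
    using realizable_iterate[OF 1 3 order_refl] unfolding w_int[symmetric]
    by (auto simp: k_def)
  then show False by (rule realizable_varies_False[OF _ _ _ 2 4]) (simp add: M_def)
qed

end

theorem theorem1:
  shows "\<exists>c::real. c > 0 \<and> (\<exists>N. \<forall>n \<ge> N. (\<exists>m. n = m * m) \<longrightarrow>
           (\<forall>A T. solves_grid_3col A n T \<longrightarrow> real T \<ge> c * ln (real n)))"
proof (rule exI[of _ "1 / 56"], intro conjI exI allI impI)
  \<comment> \<open>The bound \<open>m < 2 ^ (14 T + 21)\<close> and \<open>ln 2 \<le> 1\<close>
    give \<open>ln n \<le> 28 T + 42\<close>. The threshold \<open>exp 84\<close> makes 42 at most
    half of \<open>ln n\<close>, which leaves \<open>ln n \<le> 56 T\<close>.\<close>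
  fix n A T
  assume n: "nat \<lceil>exp 84 :: real\<rceil> \<le> n" and "\<exists>m. n = m * m" and s: "solves_grid_3col A n T"
  then obtain m where m: "n = m * m" by blast
  interpret grid_algorithm A m T by unfold_locales (use s m in simp)
  have exp_n: "exp 84 \<le> real n" using n by linarith
  have n0: "0 < real n" using exp_gt_zero exp_n by (rule less_le_trans)
  have n84: "84 \<le> ln (real n)" using ln_ge_iff[OF n0] exp_n by simp
  have m0: "0 < real m" using n0 m by (cases "m = 0") auto
  then have ln_n: "ln (real n) = 2 * ln (real m)" by (simp add: m ln_mult)
  have "real m < 2 ^ (7 * (2 * T + 3))"
    using grid_side_less by (metis of_nat_less_iff of_nat_numeral of_nat_power)
  then have "ln (real m) \<le> ln (2 ^ (7 * (2 * T + 3)))" using m0 by (intro ln_mono) auto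
  also have "\<dots> = real (7 * (2 * T + 3)) * ln 2" by (rule ln_realpow)
  also have "\<dots> \<le> real (7 * (2 * T + 3)) * 1"
    by (intro mult_left_mono) (use ln_le_minus_one[of 2] in auto)
  finally show "1 / 56 * ln (real n) \<le> real T" using n84 ln_n by simp
qed simp

end
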